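(* Let $m\ge2$, let $\Phi((w_{ij})_{1\le i<j\le m})$ be a multiaffine polynomial in the $\binom m2$ variables $w_{ij}$, and let $\alpha\in\mathbb R$. Then the following are equivalent: (i) there exists a graphon $W$ with $\Phi_W(x_1,\dots,x_m)=\alpha$ for a.e. $(x_1,\dots,x_m)\in[0,1]^m$ such that $W$ is not a.e. constant; (ii) there exists a 2-type graphon $W$ with $\Phi_W(x_1,\dots,x_m)=\alpha$ for all $(x_1,\dots,x_m)\in[0,1]^m$ such that $W$ is not (a.e.) constant; (iii) there exist $u,v,s\in[0,1]$, not all equal, such that for every $A\subseteq[m]$, setting $w_{ij}=u$ if $i,j\in A$, $w_{ij}=v$ if $i,j\notin A$, and $w_{ij}=s$ if exactly one of $i,j$ lies in $A$, we have $\Phi((w_{ij})_{i<j})=\alpha$.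
   Context: A multiaffine polynomial is a polynomial in which each variable has degree at most 1. A graphon is a symmetric measurable $W:[0,1]^2\to[0,1]$. For a graphon $W$, $\Phi_W(x_1,\dots,x_m)=\Phi((W(x_i,x_j))_{i<j})$. A graphon is 2-type if there is a partition of $[0,1]$ into two measurable sets $S_1,S_2$ such that $W$ is constant on each $S_a\times S_b$, $a,b\in\{1,2\}$. *)

theory Defs
  imports "HOL-Analysis.Analysis" "HOL-Library.Poly_Mapping"
begin

text \<open>
  A real polynomial in variables of type \<open>'v\<close> is a finitely supported map from monomials to
  coefficients, a monomial being a finitely supported map from variables to exponents.
\<close>

type_synonym 'v rpoly = "('v \<Rightarrow>\<^sub>0 nat) \<Rightarrow>\<^sub>0 real"

definition poly_vars :: "'v rpoly \<Rightarrow> 'v set" where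
  "poly_vars p = (\<Union>t\<in>Poly_Mapping.keys p. Poly_Mapping.keys t)"

definition multiaffine :: "'v rpoly \<Rightarrow> bool" where
  "multiaffine p \<longleftrightarrow> (\<forall>t\<in>Poly_Mapping.keys p. \<forall>v. Poly_Mapping.lookup t v \<le> 1)"

definition poly_eval :: "'v rpoly \<Rightarrow> ('v \<Rightarrow> real) \<Rightarrow> real" where
  "poly_eval p a =
    (\<Sum>t\<in>Poly_Mapping.keys p.
       Poly_Mapping.lookup p t * (\<Prod>v\<in>Poly_Mapping.keys t. a v ^ Poly_Mapping.lookup t v))"

definition pairs :: "nat \<Rightarrow> (nat \<times> nat) set" where
  "pairs m = {(i, j). 1 \<le> i \<and> i < j \<and> j \<le> m}"

text \<open>
  Functions on \<open>[0,1]\<^sup>2\<close> are represented by functions on the whole plane whose values outside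
  the unit square are irrelevant; measurability is Lebesgue measurability.
\<close>

definition graphon :: "(real \<Rightarrow> real \<Rightarrow> real) \<Rightarrow> bool" where
  "graphon W \<longleftrightarrow>
     (\<lambda>(x, y). W x y) \<in> borel_measurable (lebesgue_on ({0..1} \<times> {0..1})) \<and>
     (\<forall>x\<in>{0..1}. \<forall>y\<in>{0..1}. W x y \<in> {0..1} \<and> W x y = W y x)"

definition ae_constant :: "(real \<Rightarrow> real \<Rightarrow> real) \<Rightarrow> bool" where
  "ae_constant W \<longleftrightarrow> (\<exists>c. AE (x, y) in lebesgue_on ({0..1} \<times> {0..1}). W x y = c)"

definition two_type :: "(real \<Rightarrow> real \<Rightarrow> real) \<Rightarrow> bool" where
  "two_type W \<longleftrightarrow>
     (\<exists>S1 S2. S1 \<in> sets lebesgue \<and> S2 \<in> sets lebesgue \<and>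
        S1 \<union> S2 = {0..1} \<and> S1 \<inter> S2 = {} \<and>
        (\<forall>A\<in>{S1, S2}. \<forall>B\<in>{S1, S2}. (\<lambda>(x, y). W x y) constant_on (A \<times> B)))"

definition Phi_graphon ::
    "(nat \<times> nat) rpoly \<Rightarrow> (real \<Rightarrow> real \<Rightarrow> real) \<Rightarrow> (nat \<Rightarrow> real) \<Rightarrow> real" where
  "Phi_graphon \<Phi> W x = poly_eval \<Phi> (\<lambda>(i, j). W (x i) (x j))"

text \<open>
  Lebesgue measure on \<open>[0,1]\<^sup>m\<close>, up to completion; since \<open>AE\<close> only asks that the exceptional
  set be contained in a null set, almost-everywhere statements do not depend on the completion.
\<close>

definition cube_measure :: "nat \<Rightarrow> (nat \<Rightarrow> real) measure" where
  "cube_measure m = (\<Pi>\<^sub>M i\<in>{1..m}. lebesgue_on {0..1})"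

definition block_weight ::
    "real \<Rightarrow> real \<Rightarrow> real \<Rightarrow> nat set \<Rightarrow> nat \<times> nat \<Rightarrow> real" where
  "block_weight u v s A = (\<lambda>(i, j).
     if i \<in> A \<and> j \<in> A then u else if i \<notin> A \<and> j \<notin> A then v else s)"

end

theory Submission
  imports Defs "HOL-Probability.Infinite_Product_Measure"
begin

text \<open>
  If \<open>W\<close> is not a.e. constant, then \<open>{W \<le> p}\<close> and \<open>{q \<le> W}\<close> both have positive measure for some
  \<open>p < q\<close>. Independent uniform points form, with positive probability, two complete bipartite
  patterns of any given size, one inside each of these sets, and almost surely every injective choice
  of \<open>m\<close> of these points satisfies the identity. By compactness the values of \<open>W\<close> at such points converge, as the
  size grows, to an infinite array consisting of four groups of indices. Iterated limits in this array make
  it constant inside the groups and between any two of them, so every pair of groups yields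
  a triple \<open>(u, v, s)\<close> as in (iii). The two bipartite patterns have \<open>s \<le> p\<close> and \<open>s \<ge> q\<close>; if both
  triples were trivial, the triple of two groups from different patterns would not be.
\<close>

section \<open>Evaluation of polynomials and pointwise compactness\<close>

lemma poly_eval_tendsto:
  assumes "\<And>v. v \<in> poly_vars p \<Longrightarrow> ((\<lambda>n. a n v) \<longlongrightarrow> b v) G"
  shows "((\<lambda>n. poly_eval p (a n)) \<longlongrightarrow> poly_eval p b) G"
  unfolding poly_eval_def
  by (intro tendsto_intros assms) (auto simp: poly_vars_def)

lemma poly_eval_cong:
  assumes "\<And>v. v \<in> poly_vars p \<Longrightarrow> a v = b v"
  shows "poly_eval p a = poly_eval p b"
  unfolding poly_eval_def
  by (intro sum.cong prod.cong arg_cong2[where f="(*)"] arg_cong2[where f="(^)"] assms refl)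
    (auto simp: poly_vars_def)

text \<open>By Tychonoff's theorem the product of copies of \<open>K\<close> is compact.
  Countability of the index type makes the product topology first countable, so this compactness is
  also sequential, and convergence in the product is pointwise.\<close>

lemma convergent_subseq_pointwise:
  fixes f :: "nat \<Rightarrow> 'a::countable \<Rightarrow> 'b::metric_space"
  assumes "compact K" and "\<And>n a. f n a \<in> K"
  obtains r l where "strict_mono (r :: nat \<Rightarrow> nat)" and "\<And>a. (\<lambda>n. f (r n) a) \<longlonglongrightarrow> l a"
    and "\<And>a. l a \<in> K"
proof -
  have "compactin euclidean (PiE UNIV (\<lambda>_::'a. K))"
    using compactin_PiE[of "\<lambda>_::'a. euclidean" UNIV "\<lambda>_. K"] assms(1)
    by (simp add: euclidean_product_topology)
  then have "seq_compact (PiE UNIV (\<lambda>_::'a. K))"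
    by (simp add: compact_imp_seq_compact)
  moreover have "\<forall>n. f n \<in> PiE UNIV (\<lambda>_. K)"
    using assms(2) by auto
  ultimately obtain l r where l: "l \<in> PiE UNIV (\<lambda>_. K)" and r: "strict_mono r"
    and lim: "(f \<circ> r) \<longlonglongrightarrow> l"
    by (rule seq_compactE)
  have "(\<lambda>n. f (r n) a) \<longlonglongrightarrow> l a" for a
  proof -
    have "continuous_on UNIV (\<lambda>x :: 'a \<Rightarrow> 'b. x a)"
      by (rule continuous_on_product_then_coordinatewise) (rule continuous_on_id)
    then have "isCont (\<lambda>x :: 'a \<Rightarrow> 'b. x a) l"
      using continuous_on_eq_continuous_at[OF open_UNIV] by blast
    from isCont_tendsto_compose[OF this lim] show ?thesis
      by (simp add: o_def)
  qed
  with l r show thesis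
    by (intro that[of r l]) auto
qed

subsection \<open>Iterated limits of arrays\<close>

text \<open>
  Below, \<open>s g g'\<close> is the iterated limit of \<open>w (g, k) (g', l)\<close> as first \<open>l\<close> and then \<open>k\<close> tends to
  infinity. In general it is not symmetric in \<open>g\<close> and \<open>g'\<close>, even if \<open>w\<close> is.
\<close>

definition iterated_limits ::
    "('g \<times> nat \<Rightarrow> 'g \<times> nat \<Rightarrow> real) \<Rightarrow> (nat \<Rightarrow> nat) \<Rightarrow> ('g \<times> nat \<Rightarrow> 'g \<Rightarrow> real) \<Rightarrow>
      ('g \<Rightarrow> 'g \<Rightarrow> real) \<Rightarrow> bool" where
  "iterated_limits w r F s \<longleftrightarrow> strict_mono r \<and>
     (\<forall>x g. (\<lambda>k. w x (g, r k)) \<longlonglongrightarrow> F x g) \<and> (\<forall>g g'. (\<lambda>k. F (g, r k) g') \<longlonglongrightarrow> s g g')"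

text \<open>Two successive extractions: \<open>r1\<close> makes every row converge within each
  group, and \<open>r2\<close> thins it so that the row limits converge as well. The row limits
  survive the thinning, so the composition serves both purposes.\<close>

lemma ex_iterated_limits:
  fixes w :: "'g::countable \<times> nat \<Rightarrow> 'g \<times> nat \<Rightarrow> real"
  assumes "compact K" and "\<And>x y. w x y \<in> K"
  obtains r F s where "iterated_limits w r F s" and "\<And>g g'. s g g' \<in> K"
proof -
  obtain r1 F where r1: "strict_mono (r1 :: nat \<Rightarrow> nat)"
    and F: "\<And>a. (\<lambda>n. w (fst a) (snd a, r1 n)) \<longlonglongrightarrow> F a" "\<And>a. F a \<in> K"
    by (rule convergent_subseq_pointwise[of K "\<lambda>n a. w (fst a) (snd a, n)", OF assms]) blast
  obtain r2 s where r2: "strict_mono (r2 :: nat \<Rightarrow> nat)"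
    and s: "\<And>a. (\<lambda>n. F ((fst a, r1 (r2 n)), snd a)) \<longlonglongrightarrow> s a" "\<And>a. s a \<in> K"
    by (rule convergent_subseq_pointwise[of K "\<lambda>n a. F ((fst a, r1 n), snd a)", OF assms(1) F(2)]) blast
  have "(\<lambda>k. w x (g, r1 (r2 k))) \<longlonglongrightarrow> F (x, g)" for x g
    using LIMSEQ_subseq_LIMSEQ[OF F(1)[of "(x, g)"] r2] by (simp add: o_def)
  moreover have "(\<lambda>k. F ((g, r1 (r2 k)), g')) \<longlonglongrightarrow> s (g, g')" for g g'
    using s(1)[of "(g, g')"] by simp
  ultimately have "iterated_limits w (r1 \<circ> r2) (\<lambda>x g. F (x, g)) (\<lambda>g g'. s (g, g'))"
    using r1 r2 by (simp add: iterated_limits_def strict_mono_o)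
  then show thesis
    using that s(2) by blast
qed

text \<open>The indices are chosen one after another. The invariant keeps the row limit of each
  chosen index close to its own limit for every group \<open>g j\<close> with \<open>j < N\<close>,
  including those whose index is still to be chosen. A later index then only has to bring the
  entries close to the row limits, which costs a second \<delta>; hence \<delta> is half of
  \<epsilon>.\<close>

lemma iterated_limits_close:
  assumes lims: "iterated_limits w r F s" and "\<epsilon> > 0"
  obtains k :: "nat \<Rightarrow> nat" where
    "\<And>i j. \<lbrakk>i < j; j < N\<rbrakk> \<Longrightarrow> k i < k j \<and> \<bar>w (g i, k i) (g j, k j) - s (g i) (g j)\<bar> < \<epsilon>"
proof -
  define \<delta> where "\<delta> = \<epsilon> / 2"
  have "\<delta> > 0" using \<open>\<epsilon> > 0\<close> by (simp add: \<delta>_def)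
  have r: "strict_mono r"
    and F: "\<And>x g. (\<lambda>k. w x (g, r k)) \<longlonglongrightarrow> F x g"
    and s: "\<And>g g'. (\<lambda>k. F (g, r k) g') \<longlonglongrightarrow> s g g'"
    using lims by (auto simp: iterated_limits_def)
  have "\<exists>k. (\<forall>j<n. \<forall>i<j. k i < k j \<and> \<bar>w (g i, k i) (g j, k j) - s (g i) (g j)\<bar> < \<epsilon>) \<and>
          (\<forall>i<n. \<forall>j<N. \<bar>F (g i, k i) (g j) - s (g i) (g j)\<bar> < \<delta>)" if "n \<le> N" for n
    using that
  proof (induction n)
    case 0
    then show ?case by simp
  next
    case (Suc n)
    then obtain k where
      k: "\<forall>j<n. \<forall>i<j. k i < k j \<and> \<bar>w (g i, k i) (g j, k j) - s (g i) (g j)\<bar> < \<epsilon>"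
        "\<forall>i<n. \<forall>j<N. \<bar>F (g i, k i) (g j) - s (g i) (g j)\<bar> < \<delta>"
      by auto
    have "eventually (\<lambda>l. \<forall>i\<in>{..<n}. k i < r l) sequentially"
      by (intro eventually_ball_finite ballI
          eventually_compose_filterlim[OF eventually_gt_at_top filterlim_subseq[OF r]]) simp
    moreover have "eventually (\<lambda>l. \<forall>i\<in>{..<n}. \<bar>w (g i, k i) (g n, r l) - F (g i, k i) (g n)\<bar> < \<delta>) sequentially"
      using tendstoD[OF F \<open>\<delta> > 0\<close>]
      by (intro eventually_ball_finite) (auto simp: dist_real_def)
    moreover have "eventually (\<lambda>l. \<forall>j\<in>{..<N}. \<bar>F (g n, r l) (g j) - s (g n) (g j)\<bar> < \<delta>) sequentially"
      using tendstoD[OF s \<open>\<delta> > 0\<close>]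
      by (intro eventually_ball_finite) (auto simp: dist_real_def)
    ultimately have "eventually (\<lambda>l. (\<forall>i\<in>{..<n}. k i < r l) \<and>
        (\<forall>i\<in>{..<n}. \<bar>w (g i, k i) (g n, r l) - F (g i, k i) (g n)\<bar> < \<delta>) \<and>
        (\<forall>j\<in>{..<N}. \<bar>F (g n, r l) (g j) - s (g n) (g j)\<bar> < \<delta>)) sequentially"
      by eventually_elim auto
    then obtain l where l: "\<forall>i\<in>{..<n}. k i < r l"
        "\<forall>i\<in>{..<n}. \<bar>w (g i, k i) (g n, r l) - F (g i, k i) (g n)\<bar> < \<delta>"
        "\<forall>j\<in>{..<N}. \<bar>F (g n, r l) (g j) - s (g n) (g j)\<bar> < \<delta>"
      using eventually_happens' sequentially_bot by blast
    have "\<bar>w (g i, k i) (g n, r l) - s (g i) (g n)\<bar> < \<epsilon>" if "i < n" for i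
    proof -
      have "\<bar>w (g i, k i) (g n, r l) - F (g i, k i) (g n)\<bar> < \<delta>"
        using l(2) that by auto
      moreover have "\<bar>F (g i, k i) (g n) - s (g i) (g n)\<bar> < \<delta>"
        using k(2) that Suc.prems by auto
      ultimately show ?thesis
        unfolding \<delta>_def by argo
    qed
    then show ?case
      using k l by (intro exI[of _ "k(n := r l)"]) (auto simp: less_Suc_eq)
  qed
  from this[of N] show thesis
    using that by auto
qed

text \<open>
  The indices in \<open>A\<close> are sent to group \<open>a\<close> and come before the remaining ones, which are sent to
  group \<open>b\<close>; all mixed pairs are then close to \<open>s a b\<close>, and \<open>s b a\<close> never occurs.
\<close>

lemma poly_eval_block_weight_of_array:
  assumes vars: "poly_vars \<Phi> \<subseteq> pairs m"
    and sym: "\<And>x y. w x y = w y x"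
    and const: "\<And>\<tau>. inj_on \<tau> {1..m} \<Longrightarrow> poly_eval \<Phi> (\<lambda>(i, j). w (\<tau> i) (\<tau> j)) = \<alpha>"
    and lims: "iterated_limits w r F s"
  shows "poly_eval \<Phi> (block_weight (s a a) (s b b) (s a b) A) = \<alpha>"
proof -
  \<comment> \<open>The shift by \<open>Suc m\<close> places the indices outside \<open>A\<close>
    after all those in \<open>A\<close>, so that \<open>g\<close> can read the side off the rank.
    Ranks of indices up to \<open>m\<close> are at most \<open>2 * m + 1\<close>, which explains the
    length \<open>2 * m + 2\<close>.\<close>
  define rank where "rank i = (if i \<in> A then i else Suc m + i)" for i :: nat
  define g where "g n = (if n \<le> m then a else b)" for n :: nat
  have "\<exists>k. \<forall>i j. i < j \<longrightarrow> j < 2 * m + 2 \<longrightarrow>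
      k i < k j \<and> \<bar>w (g i, k i) (g j, k j) - s (g i) (g j)\<bar> < 1 / Suc n" for n
  proof -
    obtain k :: "nat \<Rightarrow> nat" where
      "\<And>i j. \<lbrakk>i < j; j < 2 * m + 2\<rbrakk> \<Longrightarrow>
         k i < k j \<and> \<bar>w (g i, k i) (g j, k j) - s (g i) (g j)\<bar> < 1 / Suc n"
      using iterated_limits_close[OF lims, of "1 / Suc n" "2 * m + 2" g] by (auto simp del: of_nat_Suc)
    then show ?thesis
      by blast
  qed
  then obtain k where k: "\<And>n i j. \<lbrakk>i < j; j < 2 * m + 2\<rbrakk> \<Longrightarrow>
      k n i < k n j \<and> \<bar>w (g i, k n i) (g j, k n j) - s (g i) (g j)\<bar> < 1 / Suc n"
    by metis
  define \<tau> where "\<tau> n i = (g (rank i), k n (rank i))" for n i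
  have "inj_on (\<tau> n) {1..m}" for n
  proof (rule linorder_inj_onI')
    fix i j assume "i \<in> {1..m}" "j \<in> {1..m}" "i < j"
    then have "rank i \<noteq> rank j" "rank i < 2 * m + 2" "rank j < 2 * m + 2"
      by (auto simp: rank_def)
    then have "k n (rank i) \<noteq> k n (rank j)"
      using k[of "rank i" "rank j" n] k[of "rank j" "rank i" n] by (cases "rank i < rank j") auto
    then show "\<tau> n i \<noteq> \<tau> n j"
      by (simp add: \<tau>_def)
  qed
  then have "(\<lambda>n. poly_eval \<Phi> (\<lambda>(i, j). w (\<tau> n i) (\<tau> n j))) \<longlonglongrightarrow> \<alpha>"
    by (simp add: const)
  moreover have "(\<lambda>n. poly_eval \<Phi> (\<lambda>(i, j). w (\<tau> n i) (\<tau> n j)))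
      \<longlonglongrightarrow> poly_eval \<Phi> (block_weight (s a a) (s b b) (s a b) A)"
  proof (rule poly_eval_tendsto)
    fix v assume "v \<in> poly_vars \<Phi>"
    with vars obtain i j where v: "v = (i, j)" and ij: "1 \<le> i" "i < j" "j \<le> m"
      by (auto simp: pairs_def)
    have lim: "(\<lambda>n. w (\<tau> n i') (\<tau> n j')) \<longlonglongrightarrow> s (g (rank i')) (g (rank j'))"
      if "rank i' < rank j'" "j' \<le> m" for i' j'
    proof (rule LIMSEQ_I)
      fix e :: real assume "e > 0"
      then obtain N where N: "1 / Suc N < e"
        using nat_approx_posE by (metis)
      have "norm (w (\<tau> n i') (\<tau> n j') - s (g (rank i')) (g (rank j'))) < e" if "n \<ge> N" for n
      proof -
        have "rank j' < 2 * m + 2"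
          using \<open>j' \<le> m\<close> by (auto simp: rank_def)
        then have "\<bar>w (\<tau> n i') (\<tau> n j') - s (g (rank i')) (g (rank j'))\<bar> < 1 / Suc n"
          using k[OF \<open>rank i' < rank j'\<close>, of n] by (simp add: \<tau>_def)
        also have "\<dots> \<le> 1 / Suc N"
          using that by (intro divide_left_mono) auto
        finally show ?thesis
          using N by simp
      qed
      then show "\<exists>N. \<forall>n\<ge>N. norm (w (\<tau> n i') (\<tau> n j') - s (g (rank i')) (g (rank j'))) < e"
        by blast
    qed
    show "(\<lambda>n. case v of (i, j) \<Rightarrow> w (\<tau> n i) (\<tau> n j))
        \<longlonglongrightarrow> block_weight (s a a) (s b b) (s a b) A v"
    \<comment> \<open>This is the only case in which the ranks of \<open>i < j\<close> come in the
      reverse order; symmetry of \<open>w\<close> exchanges the two arguments.\<close>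
    proof (cases "i \<notin> A \<and> j \<in> A")
      case True
      then have "(\<lambda>n. w (\<tau> n j) (\<tau> n i)) \<longlonglongrightarrow> s (g (rank j)) (g (rank i))"
        using ij by (intro lim) (auto simp: rank_def)
      then show ?thesis
        using True ij by (simp add: v sym[of "\<tau> _ i"] block_weight_def g_def rank_def)
    next
      case False
      then have "(\<lambda>n. w (\<tau> n i) (\<tau> n j)) \<longlonglongrightarrow> s (g (rank i)) (g (rank j))"
        using ij by (intro lim) (auto simp: rank_def)
      then show ?thesis
        using False ij by (auto simp: v block_weight_def g_def rank_def)
    qed
  qed
  ultimately show ?thesis
    by (rule LIMSEQ_unique[symmetric])
qed

text \<open>In a group label, the first \<open>bool\<close> selects the pattern
  (\<open>False\<close> for the values up to \<open>p\<close>, \<open>True\<close> for those from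
  \<open>q\<close> on) and the second selects the side of the bipartition. The hypotheses speak of
  larger and larger finite parts of the arrays, so a pointwise limit satisfies them on the whole
  index set.\<close>

lemma block_weights_of_finite_arrays:
  fixes w :: "nat \<Rightarrow> (bool \<times> bool) \<times> nat \<Rightarrow> (bool \<times> bool) \<times> nat \<Rightarrow> real"
  assumes vars: "poly_vars \<Phi> \<subseteq> pairs m"
    and range: "\<And>n x y. w n x y \<in> {0..1}"
    and sym: "\<And>n x y. w n x y = w n y x"
    and const: "\<And>n \<tau>. \<lbrakk>inj_on \<tau> {1..m}; \<tau> ` {1..m} \<subseteq> UNIV \<times> {..<n}\<rbrakk>
      \<Longrightarrow> poly_eval \<Phi> (\<lambda>(i, j). w n (\<tau> i) (\<tau> j)) = \<alpha>"
    and le: "\<And>n k l. \<lbrakk>k < n; l < n\<rbrakk> \<Longrightarrow> w n ((False, False), k) ((False, True), l) \<le> p"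
    and ge: "\<And>n k l. \<lbrakk>k < n; l < n\<rbrakk> \<Longrightarrow> q \<le> w n ((True, False), k) ((True, True), l)"
    and "p < q"
  shows "\<exists>u\<in>{0..1}. \<exists>v\<in>{0..1}. \<exists>s\<in>{0..1}. \<not> (u = v \<and> v = s) \<and>
           (\<forall>A\<subseteq>{1..m}. poly_eval \<Phi> (block_weight u v s A) = \<alpha>)"
proof -
  obtain \<rho> l where \<rho>: "strict_mono (\<rho> :: nat \<Rightarrow> nat)"
    and l: "\<And>a. (\<lambda>n. w (\<rho> n) (fst a) (snd a)) \<longlonglongrightarrow> l a"
    and l01: "\<And>a. l a \<in> {0..1}"
    by (rule convergent_subseq_pointwise[of "{0..1}" "\<lambda>n a. w n (fst a) (snd a)",
          OF compact_Icc range]) blast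
  define w' where "w' x y = l (x, y)" for x y
  have w': "(\<lambda>n. w (\<rho> n) x y) \<longlonglongrightarrow> w' x y" for x y
    using l[of "(x, y)"] by (simp add: w'_def)
  have large: "eventually (\<lambda>n. N < \<rho> n) sequentially" for N
    by (rule eventually_compose_filterlim[OF eventually_gt_at_top filterlim_subseq[OF \<rho>]])
  have sym': "w' x y = w' y x" for x y
    using w'[of x y] w'[of y x] by (simp add: sym[of _ y x] LIMSEQ_unique)
  have const': "poly_eval \<Phi> (\<lambda>(i, j). w' (\<tau> i) (\<tau> j)) = \<alpha>" if inj: "inj_on \<tau> {1..m}" for \<tau>
  proof -
    \<comment> \<open>The positions used by \<tau> are bounded, so the identity applies to all
      sufficiently late arrays of the subsequence.\<close>
    have "finite (snd ` \<tau> ` {1..m})"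
      by simp
    then obtain N where N: "\<forall>x\<in>snd ` \<tau> ` {1..m}. x < N"
      using finite_nat_set_iff_bounded by blast
    have "eventually (\<lambda>n. poly_eval \<Phi> (\<lambda>(i, j). w (\<rho> n) (\<tau> i) (\<tau> j)) = \<alpha>) sequentially"
      using large[of N]
    proof eventually_elim
      case (elim n)
      have "\<tau> ` {1..m} \<subseteq> UNIV \<times> {..<\<rho> n}"
      proof
        fix x assume "x \<in> \<tau> ` {1..m}"
        then have "snd x < N"
          using N by blast
        then show "x \<in> UNIV \<times> {..<\<rho> n}"
          using elim by (cases x) auto
      qed
      then show ?case
        by (intro const inj)
    qed
    then have "(\<lambda>n. poly_eval \<Phi> (\<lambda>(i, j). w (\<rho> n) (\<tau> i) (\<tau> j))) \<longlonglongrightarrow> \<alpha>"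
      by (rule tendsto_eventually)
    moreover have "(\<lambda>n. poly_eval \<Phi> (\<lambda>(i, j). w (\<rho> n) (\<tau> i) (\<tau> j)))
        \<longlonglongrightarrow> poly_eval \<Phi> (\<lambda>(i, j). w' (\<tau> i) (\<tau> j))"
      by (intro poly_eval_tendsto) (auto intro: w')
    ultimately show ?thesis
      by (rule LIMSEQ_unique[symmetric])
  qed
  have le': "w' ((False, False), k) ((False, True), i) \<le> p" for k i
    using large[of "max k i"]
    by (intro tendsto_upperbound[OF w']) (auto elim!: eventually_mono simp: le)
  have ge': "q \<le> w' ((True, False), k) ((True, True), i)" for k i
    using large[of "max k i"]
    by (intro tendsto_lowerbound[OF w']) (auto elim!: eventually_mono simp: ge)
  obtain r F s where lims: "iterated_limits w' r F s" and s01: "\<And>g g'. s g g' \<in> {0..1}"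
    using ex_iterated_limits[of "{0..1}" w'] l01 by (auto simp: w'_def)
  have F: "\<And>x g. (\<lambda>k. w' x (g, r k)) \<longlonglongrightarrow> F x g"
    and s: "\<And>g g'. (\<lambda>k. F (g, r k) g') \<longlonglongrightarrow> s g g'"
    using lims by (auto simp: iterated_limits_def)
  have "F ((False, False), k) (False, True) \<le> p" "q \<le> F ((True, False), k) (True, True)" for k
    by (intro tendsto_upperbound[OF F] tendsto_lowerbound[OF F] always_eventually allI le' ge'; simp)+
  then have "s (False, False) (False, True) \<le> p" "q \<le> s (True, False) (True, True)"
    by (intro tendsto_upperbound[OF s] tendsto_lowerbound[OF s] always_eventually allI; simp)+
  \<comment> \<open>If all three triples were trivial, then s(FF,FT) = s(FF,FF) = s(TF,TF) =
    s(TF,TT), where F and T abbreviate the two truth values. The first number is at most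
    \<open>p\<close> and the last at least \<open>q\<close>, contradicting
    \<open>p < q\<close>.\<close>
  then have "\<not> (s (False, False) (False, False) = s (False, True) (False, True) \<and> s (False, True) (False, True) = s (False, False) (False, True)) \<or> \<not> (s (True, False) (True, False) = s (True, True) (True, True) \<and> s (True, True) (True, True) = s (True, False) (True, True)) \<or>
      \<not> (s (False, False) (False, False) = s (True, False) (True, False) \<and> s (True, False) (True, False) = s (False, False) (True, False))"
    using \<open>p < q\<close> by auto
  then obtain a b where "\<not> (s a a = s b b \<and> s b b = s a b)"
    by blast
  then show ?thesis
    using s01 poly_eval_block_weight_of_array[OF vars sym' const' lims] by blast
qed

subsection \<open>Bipartite patterns in random samples\<close>

text \<open>The section of \<open>H\<close> over a point is a product of copies of the section of
  \<open>G\<close>, so Tonelli gives \<open>H\<close> the integral of a power of the section measure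
  of \<open>G\<close>. Such an integral vanishes only if the section measure vanishes almost
  everywhere, which would make \<open>G\<close> null.\<close>

lemma emeasure_PiM_power_pos:
  assumes "prob_space N" "prob_space B" and G: "G \<in> sets (N \<Otimes>\<^sub>M B)"
    and pos: "emeasure (N \<Otimes>\<^sub>M B) G \<noteq> 0" and "finite Y"
  defines "H \<equiv> {x \<in> space (N \<Otimes>\<^sub>M PiM Y (\<lambda>_. B)). \<forall>l\<in>Y. (fst x, snd x l) \<in> G}"
  shows "H \<in> sets (N \<Otimes>\<^sub>M PiM Y (\<lambda>_. B))" and "emeasure (N \<Otimes>\<^sub>M PiM Y (\<lambda>_. B)) H \<noteq> 0"
proof -
  interpret N: prob_space N by fact
  interpret B: prob_space B by fact
  interpret BY: product_prob_space "\<lambda>_. B" Y by standard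
  interpret BY: prob_space "PiM Y (\<lambda>_. B)" by (intro prob_space_PiM B.prob_space_axioms)
  have "(\<lambda>x. (fst x, snd x l)) \<in> N \<Otimes>\<^sub>M PiM Y (\<lambda>_. B) \<rightarrow>\<^sub>M N \<Otimes>\<^sub>M B" if "l \<in> Y" for l
    using that by (intro measurable_Pair measurable_fst
        measurable_compose[OF measurable_snd measurable_component_singleton])
  from measurable_sets[OF this G]
  have "{x \<in> space (N \<Otimes>\<^sub>M PiM Y (\<lambda>_. B)). (fst x, snd x l) \<in> G} \<in> sets (N \<Otimes>\<^sub>M PiM Y (\<lambda>_. B))"
    if "l \<in> Y" for l
    using that by (simp add: vimage_def Int_def conj_commute)
  then show H: "H \<in> sets (N \<Otimes>\<^sub>M PiM Y (\<lambda>_. B))"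
    unfolding H_def using \<open>finite Y\<close> by (rule sets.sets_Collect_finite_All)
  have G_meas: "(\<lambda>a. emeasure B (Pair a -` G)) \<in> borel_measurable N"
    using G by (rule B.measurable_emeasure_Pair)
  have "emeasure (N \<Otimes>\<^sub>M PiM Y (\<lambda>_. B)) H = (\<integral>\<^sup>+a. emeasure (PiM Y (\<lambda>_. B)) (Pair a -` H) \<partial>N)"
    using H by (rule BY.emeasure_pair_measure_alt)
  also have "\<dots> = (\<integral>\<^sup>+a. emeasure B (Pair a -` G) ^ card Y \<partial>N)"
  proof (rule nn_integral_cong)
    fix a assume a: "a \<in> space N"
    have "Pair a -` G \<subseteq> space B"
      using sets.sets_into_space[OF G] by (auto simp: space_pair_measure)
    then have "Pair a -` H = PiE Y (\<lambda>_. Pair a -` G)"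
      using a by (intro set_eqI) (simp add: H_def space_pair_measure space_PiM PiE_iff, blast)
    then show "emeasure (PiM Y (\<lambda>_. B)) (Pair a -` H) = emeasure B (Pair a -` G) ^ card Y"
      using sets_Pair1[OF G] \<open>finite Y\<close> by (simp add: BY.emeasure_PiM)
  qed
  also have "\<dots> \<noteq> 0"
  proof
    assume "(\<integral>\<^sup>+a. emeasure B (Pair a -` G) ^ card Y \<partial>N) = 0"
    then have "AE a in N. emeasure B (Pair a -` G) ^ card Y = 0"
      using G_meas by (subst (asm) nn_integral_0_iff_AE) auto
    then have "AE a in N. emeasure B (Pair a -` G) = 0"
      by eventually_elim (metis power_not_zero)
    then have "(\<integral>\<^sup>+a. emeasure B (Pair a -` G) \<partial>N) = 0"
      using G_meas by (subst nn_integral_0_iff_AE) auto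
    then show False
      using pos B.emeasure_pair_measure_alt[OF G] by simp
  qed
  finally show "emeasure (N \<Otimes>\<^sub>M PiM Y (\<lambda>_. B)) H \<noteq> 0" .
qed

text \<open>\<open>merge\<close> transports the product of the two measures to the measure on the
  union of the index sets, and the preimage of \<open>S\<close> under it is \<open>R\<close>. This
  lets independent blocks of coordinates be treated separately and then joined.\<close>

lemma emeasure_PiM_split:
  assumes B: "prob_space B" and fin: "finite I" "finite J" and disj: "I \<inter> J = {}"
    and R: "R \<in> sets (PiM I (\<lambda>_. B) \<Otimes>\<^sub>M PiM J (\<lambda>_. B))"
  defines "S \<equiv> {z \<in> space (PiM (I \<union> J) (\<lambda>_. B)). (restrict z I, restrict z J) \<in> R}"
  shows "S \<in> sets (PiM (I \<union> J) (\<lambda>_. B))"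
    and "emeasure (PiM (I \<union> J) (\<lambda>_. B)) S = emeasure (PiM I (\<lambda>_. B) \<Otimes>\<^sub>M PiM J (\<lambda>_. B)) R"
proof -
  interpret B: prob_space B by fact
  interpret product_sigma_finite "\<lambda>_. B" by standard
  have [measurable]: "Measurable.pred (PiM I (\<lambda>_. B) \<Otimes>\<^sub>M PiM J (\<lambda>_. B)) (\<lambda>x. x \<in> R)"
    using R by simp
  have [measurable]: "(\<lambda>z. restrict z I) \<in> PiM (I \<union> J) (\<lambda>_. B) \<rightarrow>\<^sub>M PiM I (\<lambda>_. B)"
    "(\<lambda>z. restrict z J) \<in> PiM (I \<union> J) (\<lambda>_. B) \<rightarrow>\<^sub>M PiM J (\<lambda>_. B)"
    by (auto intro!: measurable_restrict_subset)
  show S: "S \<in> sets (PiM (I \<union> J) (\<lambda>_. B))"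
    unfolding S_def by measurable
  have "emeasure (PiM (I \<union> J) (\<lambda>_. B)) S =
      emeasure (distr (PiM I (\<lambda>_. B) \<Otimes>\<^sub>M PiM J (\<lambda>_. B)) (PiM (I \<union> J) (\<lambda>_. B)) (merge I J)) S"
    by (simp add: distr_merge[OF disj fin])
  also have "\<dots> = emeasure (PiM I (\<lambda>_. B) \<Otimes>\<^sub>M PiM J (\<lambda>_. B))
      (merge I J -` S \<inter> space (PiM I (\<lambda>_. B) \<Otimes>\<^sub>M PiM J (\<lambda>_. B)))"
    using S by (intro emeasure_distr) auto
  also have "merge I J -` S \<inter> space (PiM I (\<lambda>_. B) \<Otimes>\<^sub>M PiM J (\<lambda>_. B)) = R"
  proof -
    have "(restrict (merge I J (x, y)) I, restrict (merge I J (x, y)) J) = (x, y)"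
      and "merge I J (x, y) \<in> space (PiM (I \<union> J) (\<lambda>_. B))"
      if "(x, y) \<in> space (PiM I (\<lambda>_. B) \<Otimes>\<^sub>M PiM J (\<lambda>_. B))" for x y
      using that disj by (auto simp: space_pair_measure space_PiM PiE_iff merge_def extensional_def fun_eq_iff)
    then show ?thesis
      using sets.sets_into_space[OF R] unfolding S_def by fastforce
  qed
  finally show "emeasure (PiM (I \<union> J) (\<lambda>_. B)) S = emeasure (PiM I (\<lambda>_. B) \<Otimes>\<^sub>M PiM J (\<lambda>_. B)) R" .
qed

text \<open>
  Duplicating one coordinate of a pair raises the measures of the sections to a power, which keeps
  the probability positive. This is done first for one coordinate and then for the other.
\<close>

lemma complete_bipartite_pos:
  assumes B: "prob_space B" and E: "E \<in> sets (B \<Otimes>\<^sub>M B)" and pos: "emeasure (B \<Otimes>\<^sub>M B) E \<noteq> 0"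
    and fin: "finite I" "finite J" and disj: "I \<inter> J = {}"
  defines "S \<equiv> {z \<in> space (PiM (I \<union> J) (\<lambda>_. B)). \<forall>i\<in>I. \<forall>j\<in>J. (z i, z j) \<in> E}"
  shows "S \<in> sets (PiM (I \<union> J) (\<lambda>_. B))" and "emeasure (PiM (I \<union> J) (\<lambda>_. B)) S \<noteq> 0"
proof -
  let ?I = "PiM I (\<lambda>_. B)" and ?J = "PiM J (\<lambda>_. B)"
  interpret B: prob_space B by fact
  interpret J: prob_space ?J by (intro prob_space_PiM B.prob_space_axioms)
  interpret I: prob_space ?I by (intro prob_space_PiM B.prob_space_axioms)
  interpret BJ: pair_sigma_finite B ?J by standard
  define G where "G = {x \<in> space (B \<Otimes>\<^sub>M ?J). \<forall>l\<in>J. (fst x, snd x l) \<in> E}"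
  have G: "G \<in> sets (B \<Otimes>\<^sub>M ?J)" "emeasure (B \<Otimes>\<^sub>M ?J) G \<noteq> 0"
    using emeasure_PiM_power_pos[OF B B E pos fin(2)] by (simp_all add: G_def)
  \<comment> \<open>Only the second component of a pair can be duplicated, so the coordinate that is
    still single is moved there.\<close>
  define G' where "G' = (\<lambda>(y, a). (a, y)) -` G \<inter> space (?J \<Otimes>\<^sub>M B)"
  have G': "G' \<in> sets (?J \<Otimes>\<^sub>M B)"
    unfolding G'_def using measurable_pair_swap' G(1) by (rule measurable_sets)
  have "emeasure (?J \<Otimes>\<^sub>M B) G' = emeasure (B \<Otimes>\<^sub>M ?J) G"
    by (subst BJ.distr_pair_swap) (simp add: G'_def emeasure_distr[OF measurable_pair_swap' G(1)])
  with G have G'_pos: "emeasure (?J \<Otimes>\<^sub>M B) G' \<noteq> 0" by simp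
  define H where "H = {x \<in> space (?J \<Otimes>\<^sub>M ?I). \<forall>k\<in>I. (fst x, snd x k) \<in> G'}"
  have H: "H \<in> sets (?J \<Otimes>\<^sub>M ?I)" "emeasure (?J \<Otimes>\<^sub>M ?I) H \<noteq> 0"
    using emeasure_PiM_power_pos[OF J.prob_space_axioms B G' G'_pos fin(1)] by (simp_all add: H_def)
  have "(restrict z J, restrict z I) \<in> H \<longleftrightarrow> (\<forall>i\<in>I. \<forall>j\<in>J. (z i, z j) \<in> E)"
    if "z \<in> space (PiM (J \<union> I) (\<lambda>_. B))" for z
  proof -
    have "z i \<in> space B" if "i \<in> J \<union> I" for i
      using \<open>z \<in> _\<close> that by (auto simp: space_PiM)
    then have "restrict z J \<in> space ?J" "restrict z I \<in> space ?I" "\<And>i. i \<in> I \<Longrightarrow> z i \<in> space B"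
      by (auto simp: space_PiM)
    then show ?thesis
      by (simp add: H_def G'_def G_def space_pair_measure)
  qed
  then have "{z \<in> space (PiM (J \<union> I) (\<lambda>_. B)). (restrict z J, restrict z I) \<in> H} = S"
    unfolding S_def Un_commute[of J I] by blast
  moreover have "J \<inter> I = {}"
    using disj by blast
  ultimately show "S \<in> sets (PiM (I \<union> J) (\<lambda>_. B))" "emeasure (PiM (I \<union> J) (\<lambda>_. B)) S \<noteq> 0"
    using emeasure_PiM_split[OF B fin(2,1) _ H(1)] H(2) unfolding Un_commute[of J I] by simp_all
qed

text \<open>Coordinates selected injectively remain independent, so their joint law is again the
  product measure and the statement pulls back.\<close>

lemma AE_PiM_reindex:
  assumes "prob_space B" and "inj_on f I" "f ` I \<subseteq> K" and "AE x in PiM I (\<lambda>_. B). P x"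
  shows "AE z in PiM K (\<lambda>_. B). P (\<lambda>i\<in>I. z (f i))"
proof (rule AE_distrD[where f = "\<lambda>z. \<lambda>i\<in>I. z (f i)" and M' = "PiM I (\<lambda>_. B)"])
  show "(\<lambda>z. \<lambda>i\<in>I. z (f i)) \<in> PiM K (\<lambda>_. B) \<rightarrow>\<^sub>M PiM I (\<lambda>_. B)"
    using assms(3) by (intro measurable_restrict measurable_component_singleton) auto
  show "AE x in distr (PiM K (\<lambda>_. B)) (PiM I (\<lambda>_. B)) (\<lambda>z. \<lambda>i\<in>I. z (f i)). P x"
    using assms by (subst distr_PiM_reindex) auto
qed

subsection \<open>Graphons that are not almost everywhere constant\<close>

lemma prob_space_unit_interval: "prob_space (lebesgue_on {0..1::real})"
  by (rule prob_spaceI) (simp add: emeasure_restrict_space space_restrict_space)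

text \<open>Lebesgue sets of the square need not belong to the product of the one-dimensional
  Lebesgue sigma-algebras, where sampling takes place. The Borel main part of \<open>E\<close> does,
  and it differs from \<open>E\<close> only by a null set.\<close>

lemma borel_subset_unit_square_pos:
  fixes E :: "(real \<times> real) set"
  assumes E: "E \<in> sets (lebesgue_on ({0..1} \<times> {0..1}))" and pos: "E \<notin> null_sets (lebesgue_on ({0..1} \<times> {0..1}))"
  obtains E' where "E' \<subseteq> E" "E' \<in> sets (lebesgue_on {0..1} \<Otimes>\<^sub>M lebesgue_on {0..1})"
    "emeasure (lebesgue_on {0..1} \<Otimes>\<^sub>M lebesgue_on {0..1}) E' \<noteq> 0"
proof -
  let ?L = "lebesgue_on {0..1::real}" and ?Q = "{0..1::real} \<times> {0..1::real}"
  interpret L: prob_space ?L by (rule prob_space_unit_interval)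
  have Q: "?Q \<in> sets lebesgue"
    by (metis borel_closed closed_Times closed_atLeastAtMost sets_completionI_sets sets_lborel)
  have sub: "E \<subseteq> ?Q" and E_leb: "E \<in> sets lebesgue"
    using E Q by (auto simp: sets_restrict_space_iff)
  define E' where "E' = main_part lborel E"
  have "emeasure (lebesgue_on ?Q) E = emeasure lebesgue E"
    using Q sub by (intro emeasure_restrict_space) auto
  then have E'_pos: "emeasure lborel E' \<noteq> 0"
    using pos E E_leb by (auto simp: null_sets_def E'_def)
  have E'_sub: "E' \<subseteq> E"
    using main_part_null_part_Un[OF E_leb] unfolding E'_def by blast
  have E'_borel: "E' \<in> sets (borel \<Otimes>\<^sub>M borel)"
    unfolding borel_prod E'_def using main_part_sets[OF E_leb] by simp
  have id_meas: "(\<lambda>x. x) \<in> ?L \<rightarrow>\<^sub>M borel"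
    by (intro measurable_restrict_space1 measurable_completion) simp
  have "(\<lambda>z. (fst z, snd z)) \<in> ?L \<Otimes>\<^sub>M ?L \<rightarrow>\<^sub>M borel \<Otimes>\<^sub>M borel"
    by (intro measurable_Pair measurable_compose[OF measurable_fst id_meas]
        measurable_compose[OF measurable_snd id_meas])
  from measurable_sets[OF this E'_borel]
  have E'_sets: "E' \<in> sets (?L \<Otimes>\<^sub>M ?L)"
    using E'_sub sub by (simp add: space_pair_measure space_restrict_space Int_absorb2)
  \<comment> \<open>Both measures of \<open>E'\<close> are integrals of section measures. The
    sections are Borel subsets of the unit interval, where the two section measures agree, and they
    are empty over points outside it.\<close>
  have "emeasure lborel E' = (\<integral>\<^sup>+x. emeasure lborel (Pair x -` E') \<partial>lborel)"
    using E'_borel lborel.emeasure_pair_measure_alt[of E' lborel] by (simp add: lborel_prod borel_prod)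
  also have "\<dots> = (\<integral>\<^sup>+x. emeasure lborel (Pair x -` E') \<partial>lebesgue)"
    by (simp add: nn_integral_completion)
  also have "\<dots> = (\<integral>\<^sup>+x. emeasure lborel (Pair x -` E') * indicator {0..1} x \<partial>lebesgue)"
  proof (rule nn_integral_cong)
    fix x
    have "Pair x -` E' = {}" if "x \<notin> {0..1}"
      using that E'_sub sub by auto
    then show "emeasure lborel (Pair x -` E') = emeasure lborel (Pair x -` E') * indicator {0..1} x"
      by (cases "x \<in> {0..1}") simp_all
  qed
  also have "\<dots> = (\<integral>\<^sup>+x. emeasure lborel (Pair x -` E') \<partial>?L)"
    by (simp add: nn_integral_restrict_space)
  also have "\<dots> = (\<integral>\<^sup>+x. emeasure ?L (Pair x -` E') \<partial>?L)"
  proof (rule nn_integral_cong)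
    fix x
    have "Pair x -` E' \<in> sets borel" using E'_borel by (rule sets_Pair1)
    moreover have "Pair x -` E' \<subseteq> {0..1}" using E'_sub sub by auto
    ultimately show "emeasure lborel (Pair x -` E') = emeasure ?L (Pair x -` E')"
      by (simp add: emeasure_restrict_space)
  qed
  also have "\<dots> = emeasure (?L \<Otimes>\<^sub>M ?L) E'"
    by (rule L.emeasure_pair_measure_alt[OF E'_sets, symmetric])
  finally show thesis
    using that E'_sub E'_sets E'_pos by metis
qed

text \<open>The two patterns use disjoint sets of coordinates, so they are independent and occur
  together with probability the product of two nonzero numbers. An event of nonzero probability
  meets every almost sure event.\<close>

lemma ex_sample:
  assumes B: "prob_space B" and E: "\<And>c. E c \<in> sets (B \<Otimes>\<^sub>M B)"
    and pos: "\<And>c. emeasure (B \<Otimes>\<^sub>M B) (E c) \<noteq> 0"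
    and AE: "AE z in PiM (UNIV \<times> {..<n}) (\<lambda>_. B). P z"
  obtains z :: "(bool \<times> bool) \<times> nat \<Rightarrow> 'a"
  where "z \<in> space (PiM (UNIV \<times> {..<n}) (\<lambda>_. B))" and "P z"
    and "\<And>c k l. \<lbrakk>k < n; l < n\<rbrakk> \<Longrightarrow> (z ((c, False), k), z ((c, True), l)) \<in> E c"
proof -
  define I :: "bool \<Rightarrow> bool \<Rightarrow> ((bool \<times> bool) \<times> nat) set" where "I c d = {(c, d)} \<times> {..<n}" for c d
  define J where "J c = I c False \<union> I c True" for c
  define S where "S c = {z \<in> space (PiM (J c) (\<lambda>_. B)).
      \<forall>i\<in>I c False. \<forall>j\<in>I c True. (z i, z j) \<in> E c}" for c
  have fin: "finite (I c d)" for c d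
    by (simp add: I_def)
  have S: "S c \<in> sets (PiM (J c) (\<lambda>_. B))" "emeasure (PiM (J c) (\<lambda>_. B)) (S c) \<noteq> 0" for c
  proof -
    have "I c False \<inter> I c True = {}"
      by (auto simp: I_def)
    from complete_bipartite_pos[OF B E pos fin fin this]
    show "S c \<in> sets (PiM (J c) (\<lambda>_. B))" "emeasure (PiM (J c) (\<lambda>_. B)) (S c) \<noteq> 0"
      by (simp_all add: S_def J_def)
  qed
  have J: "finite (J c)" "J False \<inter> J True = {}" for c
    by (auto simp: J_def I_def)
  have UNIV: "J False \<union> J True = UNIV \<times> {..<n}"
    unfolding J_def I_def by (auto; metis (full_types))
  interpret T: prob_space "PiM (J True) (\<lambda>_. B)"
    using B by (intro prob_space_PiM)
  have R: "S False \<times> S True \<in> sets (PiM (J False) (\<lambda>_. B) \<Otimes>\<^sub>M PiM (J True) (\<lambda>_. B))"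
    using S(1) by simp
  define R' where "R' = {z \<in> space (PiM (UNIV \<times> {..<n}) (\<lambda>_. B)).
      (restrict z (J False), restrict z (J True)) \<in> S False \<times> S True}"
  have "R' \<in> sets (PiM (UNIV \<times> {..<n}) (\<lambda>_. B))"
    and "emeasure (PiM (UNIV \<times> {..<n}) (\<lambda>_. B)) R' = emeasure (PiM (J False) (\<lambda>_. B)) (S False)
      * emeasure (PiM (J True) (\<lambda>_. B)) (S True)"
    using emeasure_PiM_split[OF B J(1) J(1) J(2) R] S(1)
    by (simp_all add: R'_def UNIV T.emeasure_pair_measure_Times)
  then have "R' \<notin> null_sets (PiM (UNIV \<times> {..<n}) (\<lambda>_. B))"
    using S(2) by (auto simp: null_sets_def)
  then have "\<not> (AE z in PiM (UNIV \<times> {..<n}) (\<lambda>_. B). z \<notin> R')"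
    using \<open>R' \<in> sets _\<close> by (simp add: AE_iff_null_sets)
  then obtain z where z: "z \<in> R'" "P z"
    using AE by (metis (mono_tags, lifting) eventually_mono)
  have "(z ((c, False), k), z ((c, True), l)) \<in> E c" if "k < n" "l < n" for c k l
  proof -
    have "restrict z (J c) \<in> S c"
      using z(1) by (cases c) (auto simp: R'_def)
    then have "(restrict z (J c) ((c, False), k), restrict z (J c) ((c, True), l)) \<in> E c"
      using that by (auto simp: S_def I_def)
    then show ?thesis
      using that by (simp add: J_def I_def)
  qed
  with z show thesis
    using that by (auto simp: R'_def)
qed

text \<open>Otherwise, for all \<open>p < q\<close>, almost everywhere \<open>p < f x\<close> or
  almost everywhere \<open>f x < q\<close>. This dichotomy squeezes \<open>f\<close> onto its
  essential infimum.\<close>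

lemma not_AE_constant_levels:
  fixes f :: "'a \<Rightarrow> real"
  assumes f: "f \<in> borel_measurable M" and bounded: "\<And>x. x \<in> space M \<Longrightarrow> f x \<in> {0..1}"
    and nonconst: "\<not> (\<exists>c. AE x in M. f x = c)"
  obtains p q where "p < q" and "{x \<in> space M. f x \<le> p} \<notin> null_sets M"
    and "{x \<in> space M. q \<le> f x} \<notin> null_sets M"
proof (rule ccontr)
  note levels = that
  assume not_thesis: "\<not> thesis"
  have AE: "(AE x in M. p < f x) \<or> (AE x in M. f x < q)" if "p < q" for p q
  proof -
    have "{x \<in> space M. f x \<le> p} \<in> null_sets M \<or> {x \<in> space M. q \<le> f x} \<in> null_sets M"
      using levels not_thesis \<open>p < q\<close> by blast
    moreover have "(AE x in M. p < f x) \<longleftrightarrow> {x \<in> space M. f x \<le> p} \<in> null_sets M"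
      using f by (subst AE_iff_null) (auto simp: not_less)
    moreover have "(AE x in M. f x < q) \<longleftrightarrow> {x \<in> space M. q \<le> f x} \<in> null_sets M"
      using f by (subst AE_iff_null) (auto simp: not_less)
    ultimately show ?thesis
      by simp
  qed
  \<comment> \<open>The supremum of this set is the essential infimum of \<open>f\<close>; the next
    two facts show that it is finite.\<close>
  define P where "P = {p. AE x in M. p < f x}"
  have "-1 \<in> P"
    unfolding P_def mem_Collect_eq using bounded by (intro AE_I2) (smt (verit) atLeastAtMost_iff)
  have "p \<le> 1" if "p \<in> P" for p
  proof (rule ccontr)
    assume "\<not> p \<le> 1"
    \<comment> \<open>The bounds \<open>p < f x\<close> and \<open>f x\<close> at most 1 contradict
      each other, so any equation holds almost everywhere; the value 0 is arbitrary.\<close>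
    have "AE x in M. f x = 0"
      using that[unfolded P_def mem_Collect_eq] AE_space
    proof eventually_elim
      case (elim x)
      then show ?case
        using bounded[of x] \<open>\<not> p \<le> 1\<close> by auto
    qed
    then show False
      using nonconst by blast
  qed
  then have bdd: "bdd_above P"
    by (rule bdd_aboveI)
  define c where "c = Sup P"
  have "AE x in M. c - 1 / Suc n < f x \<and> f x < c + 1 / Suc n" for n
  proof -
    have "c - 1 / Suc n < Sup P"
      by (simp add: c_def)
    then obtain p where "p \<in> P" "c - 1 / Suc n < p"
      using less_cSup_iff[of P] \<open>-1 \<in> P\<close> bdd by blast
    then have 1: "AE x in M. c - 1 / Suc n < f x"
      unfolding P_def mem_Collect_eq by (auto elim: eventually_mono)
    \<comment> \<open>A level strictly between \<open>c\<close> and the desired bound already lies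
      outside \<open>P\<close>, so the dichotomy yields the upper bound.\<close>
    have "c + 1 / (2 * Suc n) \<notin> P"
      using cSup_upper[OF _ bdd] by (force simp: c_def)
    then have "AE x in M. f x < c + 1 / Suc n"
      using AE[of "c + 1 / (2 * Suc n)" "c + 1 / Suc n"] by (simp add: P_def field_simps)
    with 1 show ?thesis
      by eventually_elim simp
  qed
  then have "AE x in M. \<forall>n. c - 1 / Suc n < f x \<and> f x < c + 1 / Suc n"
    by (simp add: AE_all_countable)
  then have "AE x in M. f x = c"
  proof eventually_elim
    case (elim x)
    show ?case
    proof (rule ccontr)
      assume "f x \<noteq> c"
      then obtain n where "1 / Suc n < \<bar>f x - c\<bar>"
        using nat_approx_posE[of "\<bar>f x - c\<bar>"] by auto
      then show False
        using elim[rule_format, of n] by linarith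
    qed
  qed
  then show False
    using nonconst by blast
qed

lemma block_weights_of_graphon:
  assumes vars: "poly_vars \<Phi> \<subseteq> pairs m" and W: "graphon W"
    and AE: "AE x in cube_measure m. Phi_graphon \<Phi> W x = \<alpha>" and nonconst: "\<not> ae_constant W"
  shows "\<exists>u\<in>{0..1}. \<exists>v\<in>{0..1}. \<exists>s\<in>{0..1}. \<not> (u = v \<and> v = s) \<and>
           (\<forall>A\<subseteq>{1..m}. poly_eval \<Phi> (block_weight u v s A) = \<alpha>)"
proof -
  let ?L = "lebesgue_on {0..1::real}"
  let ?M = "lebesgue_on ({0..1::real} \<times> {0..1::real})"
  have "(\<lambda>z. W (fst z) (snd z)) \<in> borel_measurable ?M"
    and W01: "\<And>x y. \<lbrakk>x \<in> {0..1}; y \<in> {0..1}\<rbrakk> \<Longrightarrow> W x y \<in> {0..1} \<and> W x y = W y x"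
    using W by (auto simp: graphon_def case_prod_unfold)
  moreover have "\<not> (\<exists>c. AE z in ?M. W (fst z) (snd z) = c)"
    using nonconst by (simp add: ae_constant_def case_prod_unfold)
  moreover have "W (fst z) (snd z) \<in> {0..1}" if "z \<in> space ?M" for z
    using that W01 by (auto simp: space_restrict_space)
  ultimately obtain p q where "p < q"
    and p: "{z \<in> space ?M. W (fst z) (snd z) \<le> p} \<notin> null_sets ?M"
    and q: "{z \<in> space ?M. q \<le> W (fst z) (snd z)} \<notin> null_sets ?M"
    using not_AE_constant_levels[of "\<lambda>z. W (fst z) (snd z)" ?M] by blast
  have meas: "{z \<in> space ?M. W (fst z) (snd z) \<le> p} \<in> sets ?M"
    "{z \<in> space ?M. q \<le> W (fst z) (snd z)} \<in> sets ?M"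
    using \<open>(\<lambda>z. W (fst z) (snd z)) \<in> borel_measurable ?M\<close> by measurable
  obtain E0 where E0: "E0 \<subseteq> {z \<in> space ?M. W (fst z) (snd z) \<le> p}"
    "E0 \<in> sets (?L \<Otimes>\<^sub>M ?L)" "emeasure (?L \<Otimes>\<^sub>M ?L) E0 \<noteq> 0"
    using borel_subset_unit_square_pos[OF meas(1) p] by blast
  obtain E1 where E1: "E1 \<subseteq> {z \<in> space ?M. q \<le> W (fst z) (snd z)}"
    "E1 \<in> sets (?L \<Otimes>\<^sub>M ?L)" "emeasure (?L \<Otimes>\<^sub>M ?L) E1 \<noteq> 0"
    using borel_subset_unit_square_pos[OF meas(2) q] by blast
  define E where "E c = (if c then E1 else E0)" for c
  define good where "good n z \<longleftrightarrow> z \<in> space (PiM (UNIV \<times> {..<n}) (\<lambda>_. ?L)) \<and>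
      (\<forall>\<tau>. inj_on \<tau> {1..m} \<longrightarrow> \<tau> ` {1..m} \<subseteq> UNIV \<times> {..<n} \<longrightarrow>
         poly_eval \<Phi> (\<lambda>(i, j). W (z (\<tau> i)) (z (\<tau> j))) = \<alpha>) \<and>
      (\<forall>c k l. k < n \<longrightarrow> l < n \<longrightarrow> (z ((c, False), k), z ((c, True), l)) \<in> E c)"
    for n and z :: "(bool \<times> bool) \<times> nat \<Rightarrow> real"
  have "\<exists>z. good n z" for n
  proof -
    let ?K = "UNIV \<times> {..<n} :: ((bool \<times> bool) \<times> nat) set"
    \<comment> \<open>Extensional maps into a finite set are finite in number, so one null set
      accounts for all of them.\<close>
    define T where "T = {\<tau> \<in> {1..m} \<rightarrow>\<^sub>E ?K. inj_on \<tau> {1..m}}"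
    have "finite T"
      unfolding T_def by (intro finite_Collect_conjI disjI1) (simp add: finite_PiE)
    have "AE z in PiM ?K (\<lambda>_. ?L). Phi_graphon \<Phi> W (\<lambda>i\<in>{1..m}. z (\<tau> i)) = \<alpha>" if "\<tau> \<in> T" for \<tau>
    proof (rule AE_PiM_reindex[OF prob_space_unit_interval])
      show "inj_on \<tau> {1..m}" "\<tau> ` {1..m} \<subseteq> ?K"
        using that by (auto simp only: T_def mem_Collect_eq PiE_iff image_subset_iff)
      show "AE x in PiM {1..m} (\<lambda>_. ?L). Phi_graphon \<Phi> W x = \<alpha>"
        using AE unfolding cube_measure_def .
    qed
    then have AE_T: "AE z in PiM ?K (\<lambda>_. ?L). \<forall>\<tau>\<in>T. Phi_graphon \<Phi> W (\<lambda>i\<in>{1..m}. z (\<tau> i)) = \<alpha>"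
      by (intro AE_finite_allI \<open>finite T\<close>)
    have E: "E c \<in> sets (?L \<Otimes>\<^sub>M ?L)" "emeasure (?L \<Otimes>\<^sub>M ?L) (E c) \<noteq> 0" for c
      using E0 E1 by (simp_all add: E_def)
    obtain z where z: "z \<in> space (PiM ?K (\<lambda>_. ?L))"
      and zT: "\<forall>\<tau>\<in>T. Phi_graphon \<Phi> W (\<lambda>i\<in>{1..m}. z (\<tau> i)) = \<alpha>"
      and zE: "\<And>c k l. \<lbrakk>k < n; l < n\<rbrakk> \<Longrightarrow> (z ((c, False), k), z ((c, True), l)) \<in> E c"
      by (rule ex_sample[where E = E, OF prob_space_unit_interval E AE_T]) blast
    have "poly_eval \<Phi> (\<lambda>(i, j). W (z (\<tau> i)) (z (\<tau> j))) = \<alpha>"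
      if "inj_on \<tau> {1..m}" "\<tau> ` {1..m} \<subseteq> ?K" for \<tau>
    proof -
      have "restrict \<tau> {1..m} \<in> T"
        unfolding T_def using that by (simp add: inj_on_restrict_eq restrict_PiE_iff image_subset_iff)
      then have "Phi_graphon \<Phi> W (\<lambda>i\<in>{1..m}. z (restrict \<tau> {1..m} i)) = \<alpha>"
        using zT by blast
      moreover have "Phi_graphon \<Phi> W (\<lambda>i\<in>{1..m}. z (restrict \<tau> {1..m} i)) =
          poly_eval \<Phi> (\<lambda>(i, j). W (z (\<tau> i)) (z (\<tau> j)))"
        unfolding Phi_graphon_def
        using vars by (intro poly_eval_cong) (auto simp: pairs_def)
      ultimately show ?thesis
        by simp
    qed
    with z zE have "good n z"
      unfolding good_def by simp
    then show ?thesis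
      by (rule exI[of "good n"])
  qed
  then obtain z where good: "\<And>n. good n (z n)"
    by metis
  have z: "z n \<in> space (PiM (UNIV \<times> {..<n}) (\<lambda>_. ?L))"
    and z_const: "\<lbrakk>inj_on \<tau> {1..m}; \<tau> ` {1..m} \<subseteq> UNIV \<times> {..<n}\<rbrakk> \<Longrightarrow>
         poly_eval \<Phi> (\<lambda>(i, j). W (z n (\<tau> i)) (z n (\<tau> j))) = \<alpha>"
    and z_E: "\<lbrakk>k < n; l < n\<rbrakk> \<Longrightarrow> (z n ((c, False), k), z n ((c, True), l)) \<in> E c"
    for n \<tau> c k l
    using good[of n] unfolding good_def by simp_all
  \<comment> \<open>Outside its index set, \<open>z n\<close> is \<open>undefined\<close>, which need not lie in the unit interval.\<close>
  define y where "y n x = (if snd x < n then z n x else 0)" for n x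
  have y01: "y n x \<in> {0..1}" for n x
    using z[of n] by (cases x) (auto simp: y_def space_PiM PiE_iff space_restrict_space)
  show ?thesis
  proof (rule block_weights_of_finite_arrays[where w = "\<lambda>n x x'. W (y n x) (y n x')", OF vars])
    show "W (y n x) (y n x') \<in> {0..1}" "W (y n x) (y n x') = W (y n x') (y n x)" for n x x'
      using W01 y01 by blast+
  next
    fix n and \<tau> :: "nat \<Rightarrow> (bool \<times> bool) \<times> nat"
    assume \<tau>: "inj_on \<tau> {1..m}" "\<tau> ` {1..m} \<subseteq> UNIV \<times> {..<n}"
    have "y n (\<tau> i) = z n (\<tau> i)" if "i \<in> {1..m}" for i
      using \<tau>(2) that by (auto simp: y_def image_subset_iff mem_Times_iff)
    then have "poly_eval \<Phi> (\<lambda>(i, j). W (y n (\<tau> i)) (y n (\<tau> j))) =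
        poly_eval \<Phi> (\<lambda>(i, j). W (z n (\<tau> i)) (z n (\<tau> j)))"
      using vars by (intro poly_eval_cong) (auto simp: pairs_def)
    then show "poly_eval \<Phi> (\<lambda>(i, j). W (y n (\<tau> i)) (y n (\<tau> j))) = \<alpha>"
      using z_const[OF \<tau>] by simp
  next
    fix n k l :: nat assume kl: "k < n" "l < n"
    show "W (y n ((False, False), k)) (y n ((False, True), l)) \<le> p"
      using z_E[OF kl, of False] E0(1) kl by (auto simp: E_def y_def)
    show "q \<le> W (y n ((True, False), k)) (y n ((True, True), l))"
      using z_E[OF kl, of True] E1(1) kl by (auto simp: E_def y_def)
  qed fact
qed

subsection \<open>Graphons with two blocks\<close>

definition block_graphon :: "real \<Rightarrow> real \<Rightarrow> real \<Rightarrow> real \<Rightarrow> real \<Rightarrow> real" where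
  "block_graphon u v s x y =
     (if x < 1/2 \<and> y < 1/2 then u else if x \<ge> 1/2 \<and> y \<ge> 1/2 then v else s)"

lemma graphon_block_graphon:
  assumes "u \<in> {0..1}" "v \<in> {0..1}" "s \<in> {0..1}"
  shows "graphon (block_graphon u v s)"
proof -
  have "(\<lambda>(x, y). block_graphon u v s x y) \<in> borel_measurable (borel \<Otimes>\<^sub>M borel)"
    unfolding block_graphon_def by measurable
  then have "(\<lambda>(x, y). block_graphon u v s x y) \<in> borel_measurable lborel"
    by (simp add: borel_prod)
  then have "(\<lambda>(x, y). block_graphon u v s x y) \<in> borel_measurable (lebesgue_on ({0..1} \<times> {0..1}))"
    by (intro measurable_restrict_space1 measurable_completion)
  then show ?thesis
    using assms by (auto simp: graphon_def block_graphon_def)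
qed

lemma two_type_block_graphon: "two_type (block_graphon u v s)"
  unfolding two_type_def
proof (intro exI conjI)
  show "{0..<1/2::real} \<in> sets lebesgue" "{1/2..1::real} \<in> sets lebesgue"
    by simp_all
  show "\<forall>A\<in>{{0..<1/2}, {1/2..1}}. \<forall>B\<in>{{0..<1/2}, {1/2..1}}.
      (\<lambda>(x, y). block_graphon u v s x y) constant_on (A \<times> B)"
    by (auto simp: constant_on_def block_graphon_def)
qed auto

text \<open>Each of the three values is taken on a box of positive measure, so a constant equal to
  the graphon almost everywhere equals all three.\<close>

lemma not_ae_constant_block_graphon:
  assumes "\<not> (u = v \<and> v = s)"
  shows "\<not> ae_constant (block_graphon u v s)"
proof
  let ?M = "lebesgue_on ({0..1::real} \<times> {0..1::real})"
  assume "ae_constant (block_graphon u v s)"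
  then obtain c where c: "AE z in ?M. block_graphon u v s (fst z) (snd z) = c"
    by (auto simp: ae_constant_def case_prod_unfold)
  have box: "cbox (a, b) (a', b') \<in> sets lebesgue" for a b a' b' :: real
    by simp
  have const: "d = c" if "0 \<le> a" "a < a'" "a' \<le> 1" "0 \<le> b" "b < b'" "b' \<le> 1"
    and d: "\<And>x y. \<lbrakk>a \<le> x; x \<le> a'; b \<le> y; y \<le> b'\<rbrakk> \<Longrightarrow> block_graphon u v s x y = d"
  for a a' b b' d
  proof (rule ccontr)
    assume "d \<noteq> c"
    have M: "{0..1::real} \<times> {0..1::real} \<in> sets lebesgue"
      using box[of 0 0 1 1] by (simp add: cbox_Pair_eq)
    have sub: "cbox (a, b) (a', b') \<subseteq> {0..1} \<times> {0..1}"
      using that by (auto simp: cbox_Pair_eq)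
    have "AE z in ?M. z \<notin> cbox (a, b) (a', b')"
      using c
    proof eventually_elim
      case (elim z)
      then show ?case
        using d[of "fst z" "snd z"] \<open>d \<noteq> c\<close> by (cases z) (auto simp: cbox_Pair_eq)
    qed
    moreover have "cbox (a, b) (a', b') \<in> sets ?M"
      using sub M box by (simp add: sets_restrict_space_iff)
    ultimately have "emeasure ?M (cbox (a, b) (a', b')) = 0"
      using AE_iff_null_sets null_setsD1 by blast
    then have "emeasure lborel (cbox (a, b) (a', b')) = 0"
      using sub M by (simp add: emeasure_restrict_space)
    then show False
      using that by (auto simp: emeasure_lborel_cbox_eq Basis_prod_def inner_prod_def
          prod.union_disjoint prod.reindex split: if_splits)
  qed
  \<comment> \<open>The boxes are closed and the point 1/2 belongs to the upper class, so boxes in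
    the lower class stop at 1/4.\<close>
  have "u = c" by (rule const[of 0 "1/4" 0 "1/4"]) (auto simp: block_graphon_def)
  moreover have "v = c" by (rule const[of "1/2" 1 "1/2" 1]) (auto simp: block_graphon_def)
  moreover have "s = c" by (rule const[of 0 "1/4" "1/2" 1]) (auto simp: block_graphon_def)
  ultimately show False
    using assms by simp
qed

text \<open>Only the side of 1/2 on which each coordinate lies matters. Condition (iii) for all
  subsets thus gives the identity at every point, with no exceptional set.\<close>

lemma Phi_graphon_block_graphon:
  assumes "poly_vars \<Phi> \<subseteq> pairs m"
  shows "Phi_graphon \<Phi> (block_graphon u v s) x =
    poly_eval \<Phi> (block_weight u v s {i \<in> {1..m}. x i < 1/2})"
  unfolding Phi_graphon_def
  using assms by (intro poly_eval_cong) (auto simp: pairs_def block_graphon_def block_weight_def)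

section \<open>The cycle of implications\<close>

theorem theoremA5:
  fixes m :: nat and \<Phi> :: "(nat \<times> nat) rpoly" and \<alpha> :: real
  assumes "m \<ge> 2"
    and "poly_vars \<Phi> \<subseteq> pairs m"
    and "multiaffine \<Phi>"
  shows
    "((\<exists>W. graphon W \<and> (AE x in cube_measure m. Phi_graphon \<Phi> W x = \<alpha>) \<and> \<not> ae_constant W)
        \<longleftrightarrow>
      (\<exists>W. graphon W \<and> two_type W \<and>
         (\<forall>x\<in>{1..m} \<rightarrow> {0..1}. Phi_graphon \<Phi> W x = \<alpha>) \<and> \<not> ae_constant W))
     \<and>
     ((\<exists>W. graphon W \<and> two_type W \<and>
         (\<forall>x\<in>{1..m} \<rightarrow> {0..1}. Phi_graphon \<Phi> W x = \<alpha>) \<and> \<not> ae_constant W)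
        \<longleftrightarrow>
      (\<exists>u\<in>{0..1}. \<exists>v\<in>{0..1}. \<exists>s\<in>{0..1}. \<not> (u = v \<and> v = s) \<and>
         (\<forall>A\<subseteq>{1..m}. poly_eval \<Phi> (block_weight u v s A) = \<alpha>)))"
    (is "(?i \<longleftrightarrow> ?ii) \<and> (?ii \<longleftrightarrow> ?iii)")
proof -
  \<comment> \<open>The equivalences follow from the cycle (i) to (iii) to (ii) to (i); only this
    first implication needs the sampling argument.\<close>
  have "?i \<Longrightarrow> ?iii"
    using block_weights_of_graphon[OF assms(2)] by blast
  moreover have "?ii \<Longrightarrow> ?i"
  proof (elim exE conjE)
    fix W
    assume W: "graphon W" "\<not> ae_constant W"
      and \<alpha>: "\<forall>x\<in>{1..m} \<rightarrow> {0..1}. Phi_graphon \<Phi> W x = \<alpha>"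
    have "AE x in cube_measure m. Phi_graphon \<Phi> W x = \<alpha>"
      using \<alpha> by (intro AE_I2) (auto simp: cube_measure_def space_PiM space_restrict_space PiE_iff)
    with W show ?i
      by blast
  qed
  moreover have "?iii \<Longrightarrow> ?ii"
  proof (elim bexE conjE)
    fix u v s :: real
    assume uvs: "u \<in> {0..1}" "v \<in> {0..1}" "s \<in> {0..1}" "\<not> (u = v \<and> v = s)"
      and \<alpha>: "\<forall>A\<subseteq>{1..m}. poly_eval \<Phi> (block_weight u v s A) = \<alpha>"
    have "Phi_graphon \<Phi> (block_graphon u v s) x = \<alpha>" for x
      unfolding Phi_graphon_block_graphon[OF assms(2)] by (intro \<alpha>[rule_format] Collect_subset)
    then show ?ii
      using graphon_block_graphon[OF uvs(1-3)] two_type_block_graphon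
        not_ae_constant_block_graphon[OF uvs(4)] by blast
  qed
  ultimately show ?thesis
    by blast
qed

end
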